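(* Let $S\subseteq\mathbb{N}^d$ be a $\mathcal{C}$-semigroup, let $\prec$ be a term order on $\mathbb{N}^d$, and let $F(S)_\prec$ denote the Frobenius element of $S$ with respect to $\prec$. Then $S$ is a $\prec$-symmetric semigroup if and only if for each $g\in\mathrm{cone}(S)\cap\mathbb{N}^d$ we have $$g\in S\iff F(S)_\prec-g\notin S.$$
   Context: $\mathbb{N}$ denotes the non-negative integers. An affine semigroup $S$ is a finitely generated submonoid of $\mathbb{N}^d$, with minimal generating set $\{a_1,\dots,a_n\}$. Put $\mathrm{cone}(S)=\{\sum_{i=1}^n\lambda_i a_i\mid \lambda_i\in\mathbb{Q}_{\ge 0}\}$ and $\mathcal{H}(S)=(\mathrm{cone}(S)\setminus S)\cap\mathbb{N}^d$. The set of pseudo-Frobenius elements is $\mathrm{PF}(S)=\{f\in\mathcal{H}(S)\mid f+s\in S \text{ for all } s\in S\setminus\{0\}\}$. $S$ is an MPD-semigroup if $\mathrm{PF}(S)\neq\emptyset$. $S$ is a $\mathcal{C}$-semigroup if it is an MPD-semigroup and $\mathcal{H}(S)$ is non-empty and finite (non-empty finiteness of $\mathcal{H}(S)$ in fact forces $\mathrm{PF}(S)\ne\emptyset$). A term order (monomial ordering) on $\mathbb{N}^d$ is a total order $\prec$ compatible with addition and with $0\prec a$ for all $a\neq 0$. The Frobenius element with respect to $\prec$ is $F(S)_\prec=\max_\prec\mathcal{H}(S)$ (if it exists; it always exists when $\mathcal{H}(S)$ is finite and non-empty). $S$ is $\prec$-symmetric if $F(S)_\prec$ exists and $\mathrm{PF}(S)=\{F(S)_\prec\}$.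 *)

theory Defs
  imports "HOL-Analysis.Analysis"
begin

definition submonoid :: "'a::comm_monoid_add set \<Rightarrow> bool"
  where "submonoid T \<longleftrightarrow> 0 \<in> T \<and> (\<forall>x\<in>T. \<forall>y\<in>T. x + y \<in> T)"

definition affine_semigroup :: "(nat ^ 'd) set \<Rightarrow> bool"
  where "affine_semigroup S \<longleftrightarrow> (\<exists>A. finite A \<and> submonoid hull A = S)"

definition minimal_generating_set :: "(nat ^ 'd) set \<Rightarrow> (nat ^ 'd) set \<Rightarrow> bool"
  where "minimal_generating_set A S \<longleftrightarrow>
    submonoid hull A = S \<and> (\<forall>B. B \<subset> A \<longrightarrow> submonoid hull B \<noteq> S)"

text \<open>The definite description is justified by \<open>ex1_minimal_generating_set\<close> below.\<close>

definition min_gens :: "(nat ^ 'd) set \<Rightarrow> (nat ^ 'd) set"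
  where "min_gens S = (THE A. minimal_generating_set A S)"

text \<open>The embedding of $\mathbb{N}^d$ into $\mathbb{Q}^d$. It also serves to form differences of
  elements of $\mathbb{N}^d$, since subtraction on \<^typ>\<open>nat\<close> is truncated.\<close>

definition qvec :: "nat ^ 'd \<Rightarrow> rat ^ 'd"
  where "qvec x = (\<chi> i. of_nat (x $ i))"

definition rat_cone :: "(nat ^ 'd) set \<Rightarrow> (rat ^ 'd) set"
  where "rat_cone S = {(\<Sum>a\<in>min_gens S. l a *s qvec a) | l. \<forall>a\<in>min_gens S. 0 \<le> l a}"

text \<open>$(\mathrm{cone}(S) \setminus S) \cap \mathbb{N}^d$, as a subset of $\mathbb{N}^d$.\<close>

definition gaps :: "(nat ^ 'd) set \<Rightarrow> (nat ^ 'd) set"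
  where "gaps S = {x. qvec x \<in> rat_cone S - qvec ` S}"

definition pseudo_Frobenius :: "(nat ^ 'd) set \<Rightarrow> (nat ^ 'd) set"
  where "pseudo_Frobenius S = {f \<in> gaps S. \<forall>s\<in>S - {0}. f + s \<in> S}"

definition MPD_semigroup :: "(nat ^ 'd) set \<Rightarrow> bool"
  where "MPD_semigroup S \<longleftrightarrow> affine_semigroup S \<and> pseudo_Frobenius S \<noteq> {}"

definition C_semigroup :: "(nat ^ 'd) set \<Rightarrow> bool"
  where "C_semigroup S \<longleftrightarrow> MPD_semigroup S \<and> gaps S \<noteq> {} \<and> finite (gaps S)"

text \<open>The strict order relation is the parameter.\<close>

definition term_order :: "(nat ^ 'd \<Rightarrow> nat ^ 'd \<Rightarrow> bool) \<Rightarrow> bool"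
  where "term_order prec \<longleftrightarrow> irreflp prec \<and> transp prec \<and> totalp prec \<and>
    (\<forall>a b c. prec a b \<longrightarrow> prec (a + c) (b + c)) \<and> (\<forall>a. a \<noteq> 0 \<longrightarrow> prec 0 a)"

definition is_Frobenius_element ::
    "(nat ^ 'd \<Rightarrow> nat ^ 'd \<Rightarrow> bool) \<Rightarrow> (nat ^ 'd) set \<Rightarrow> nat ^ 'd \<Rightarrow> bool"
  where "is_Frobenius_element prec S f \<longleftrightarrow> f \<in> gaps S \<and> (\<forall>h\<in>gaps S. h \<noteq> f \<longrightarrow> prec h f)"

text \<open>Meaningful whenever a maximum exists; see \<open>ex1_Frobenius_element\<close> below.\<close>

definition Frobenius_element ::
    "(nat ^ 'd \<Rightarrow> nat ^ 'd \<Rightarrow> bool) \<Rightarrow> (nat ^ 'd) set \<Rightarrow> nat ^ 'd"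
  where "Frobenius_element prec S = (THE f. is_Frobenius_element prec S f)"

definition symmetric_semigroup ::
    "(nat ^ 'd \<Rightarrow> nat ^ 'd \<Rightarrow> bool) \<Rightarrow> (nat ^ 'd) set \<Rightarrow> bool"
  where "symmetric_semigroup prec S \<longleftrightarrow> (\<exists>f. is_Frobenius_element prec S f) \<and>
    pseudo_Frobenius S = {Frobenius_element prec S}"

lemma submonoid_hull: "submonoid (submonoid hull A)"
  by (rule hull_in) (auto simp: submonoid_def)

lemma ex1_minimal_generating_set:
  fixes S :: "(nat ^ 'd) set"
  assumes "affine_semigroup S"
  shows "\<exists>!A. minimal_generating_set A S"
proof -
  define atoms where "atoms = {a \<in> S - {0}. \<forall>b\<in>S. \<forall>c\<in>S. a = b + c \<longrightarrow> b = 0 \<or> c = 0}"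
  have S: "submonoid S"
    using assms submonoid_hull unfolding affine_semigroup_def by blast
  define m :: "nat ^ 'd \<Rightarrow> nat" where "m x = (\<Sum>i\<in>UNIV. x $ i)" for x
  have m_add: "m (x + y) = m x + m y" for x y
    by (simp add: m_def sum.distrib)
  have m_pos: "m x > 0" if "x \<noteq> 0" for x
    using that by (auto simp: m_def vec_eq_iff intro!: sum_pos2)
  have sub: "atoms \<subseteq> A" if "submonoid hull A = S" for A
  proof -
    define T where "T = {x \<in> S. x \<in> A \<or> x \<notin> atoms}"
    have "submonoid T"
      unfolding submonoid_def
    proof (intro conjI ballI)
      show "0 \<in> T" using S by (simp add: T_def atoms_def submonoid_def)
      fix x y assume *: "x \<in> T" "y \<in> T"
      have xy: "x \<in> S" "y \<in> S" using * by (auto simp: T_def)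
      have "x + y \<in> S" using xy S by (auto simp: submonoid_def)
      show "x + y \<in> T"
      proof (cases "x + y \<in> atoms")
        case True
        then have "x = 0 \<or> y = 0" using xy unfolding atoms_def by blast
        then show ?thesis using * by auto
      next
        case False
        then show ?thesis using \<open>x + y \<in> S\<close> by (simp add: T_def)
      qed
    qed
    moreover have "A \<subseteq> T"
      using that hull_subset[of A submonoid] by (auto simp: T_def)
    ultimately have "S \<subseteq> T" using that hull_minimal by metis
    then show ?thesis by (auto simp: T_def atoms_def)
  qed
  have "x \<in> submonoid hull atoms" if "x \<in> S" for x
    using that
  proof (induction "m x" arbitrary: x rule: less_induct)
    case less
    show ?case
    proof (cases "x = 0 \<or> x \<in> atoms")
      case True
      then show ?thesis
        using submonoid_hull[of atoms] hull_subset[of atoms submonoid]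
        by (auto simp: submonoid_def)
    next
      case False
      then obtain b c where bc: "b \<in> S" "c \<in> S" "x = b + c" "b \<noteq> 0" "c \<noteq> 0"
        using less.prems unfolding atoms_def by blast
      have "m b < m x" "m c < m x"
        using m_pos[OF bc(4)] m_pos[OF bc(5)] bc(3) by (auto simp: m_add)
      then show ?thesis
        using less.hyps bc submonoid_hull[of atoms] unfolding submonoid_def by blast
    qed
  qed
  moreover have "submonoid hull atoms \<subseteq> S"
    by (rule hull_minimal) (use S in \<open>auto simp: atoms_def\<close>)
  ultimately have gen: "submonoid hull atoms = S" by blast
  show ?thesis
  proof (rule ex1I)
    show "minimal_generating_set atoms S"
      unfolding minimal_generating_set_def using gen sub by blast
    show "A = atoms" if "minimal_generating_set A S" for A
      using that gen sub unfolding minimal_generating_set_def by blast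
  qed
qed

lemma ex1_Frobenius_element:
  fixes S :: "(nat ^ 'd) set"
  assumes "term_order prec" "finite (gaps S)" "gaps S \<noteq> {}"
  shows "\<exists>!f. is_Frobenius_element prec S f"
proof -
  have irr: "\<not> prec x x" for x
    using assms(1) by (auto simp: term_order_def dest: irreflpD)
  have tr: "prec x z" if "prec x y" "prec y z" for x y z
    using assms(1) that by (auto simp: term_order_def dest: transpD)
  have tot: "prec x y \<or> prec y x" if "x \<noteq> y" for x y
    using assms(1) that by (auto simp: term_order_def dest: totalpD)
  have "\<exists>f\<in>H. \<forall>h\<in>H. h \<noteq> f \<longrightarrow> prec h f" if "finite H" "H \<noteq> {}" for H
    using that
  proof (induction rule: finite_ne_induct)
    case (insert x H)
    then obtain f where f: "f \<in> H" "\<And>h. h \<in> H \<Longrightarrow> h \<noteq> f \<Longrightarrow> prec h f" by blast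
    have "x \<noteq> f" using f insert by blast
    then consider "prec x f" | "prec f x" using tot by blast
    then show ?case
    proof cases
      case 1
      then show ?thesis using f by (intro bexI[of _ f]) auto
    next
      case 2
      have "prec h x" if "h \<in> H" for h
        using 2 f(2)[OF that] tr[of h f x] by (cases "h = f") auto
      then show ?thesis by (intro bexI[of _ x]) auto
    qed
  qed simp
  with assms(2,3) obtain f where f: "is_Frobenius_element prec S f"
    unfolding is_Frobenius_element_def by blast
  show ?thesis
  proof (rule ex1I)
    show "is_Frobenius_element prec S f" by (rule f)
    fix g assume g: "is_Frobenius_element prec S g"
    show "g = f"
    proof (rule ccontr)
      assume "g \<noteq> f"
      then have "prec g f" "prec f g"
        using f g by (auto simp: is_Frobenius_element_def)
      then show False using irr tr by blast
    qed
  qed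
qed

end

theory Submission
  imports Defs
begin

text \<open>A gap \<open>g\<close> lies below some pseudo-Frobenius element: among the finitely many gaps of the form
  \<open>g + s\<close> with \<open>s \<in> S\<close>, a maximal one becomes an element of \<open>S\<close> as soon as any nonzero element of
  \<open>S\<close> is added. If the Frobenius element \<open>F\<close> is the only pseudo-Frobenius element, this yields
  \<open>F - g \<in> S\<close>. Conversely, \<open>F\<close> is always pseudo-Frobenius, and any other pseudo-Frobenius element
  \<open>f\<close> has \<open>F - f \<notin> S\<close>, since otherwise \<open>F = f + (F - f) \<in> S\<close>.\<close>

lemma qvec_add: "qvec (x + y) = qvec x + qvec y"
  by (simp add: qvec_def vec_eq_iff)

lemma qvec_eq_iff [simp]: "qvec x = qvec y \<longleftrightarrow> x = y"
  by (simp add: qvec_def vec_eq_iff)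

lemma qvec_in_image_iff [simp]: "qvec x \<in> qvec ` S \<longleftrightarrow> x \<in> S"
  by (auto simp: image_iff)

text \<open>Replaces a difference in \<open>rat ^ 'd\<close> by an additive equation in
  \<open>nat ^ 'd\<close>, so that the main argument needs no subtraction.\<close>

lemma qvec_diff_in_image_iff:
  "qvec x - qvec y \<in> qvec ` S \<longleftrightarrow> (\<exists>s\<in>S. x = y + s)"
proof -
  have "qvec x - qvec y = qvec s \<longleftrightarrow> x = y + s" for s
    by (metis qvec_add qvec_eq_iff diff_eq_eq add.commute)
  then show ?thesis by auto
qed

lemma gaps_iff: "x \<in> gaps S \<longleftrightarrow> qvec x \<in> rat_cone S \<and> x \<notin> S"
  by (simp add: gaps_def)

lemma affine_semigroup_submonoid: "affine_semigroup S \<Longrightarrow> submonoid S"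
  unfolding affine_semigroup_def using submonoid_hull by blast

lemma minimal_generating_set_min_gens:
  "affine_semigroup S \<Longrightarrow> minimal_generating_set (min_gens S) S"
  unfolding min_gens_def by (rule theI') (rule ex1_minimal_generating_set)

text \<open>Shrinking a finite generating set while a proper subset still generates ends in a finite
  minimal one, and uniqueness identifies it with \<open>min_gens S\<close>.\<close>

lemma finite_min_gens:
  assumes "affine_semigroup S"
  shows "finite (min_gens S)"
proof -
  obtain A where "finite A" "submonoid hull A = S"
    using assms unfolding affine_semigroup_def by blast
  then have "\<exists>B. finite B \<and> minimal_generating_set B S"
  proof (induction A rule: finite_psubset_induct)
    case (psubset A)
    then show ?case
      unfolding minimal_generating_set_def by blast
  qed
  then show ?thesis
    using ex1_minimal_generating_set[OF assms] minimal_generating_set_min_gens[OF assms] by blast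
qed

lemma rat_cone_add:
  assumes "u \<in> rat_cone S" "v \<in> rat_cone S"
  shows "u + v \<in> rat_cone S"
proof -
  obtain k l where "u = (\<Sum>a\<in>min_gens S. k a *s qvec a)" "\<forall>a\<in>min_gens S. 0 \<le> k a"
    "v = (\<Sum>a\<in>min_gens S. l a *s qvec a)" "\<forall>a\<in>min_gens S. 0 \<le> l a"
    using assms unfolding rat_cone_def by blast
  then show ?thesis
    unfolding rat_cone_def
    by (auto simp: sum.distrib vec.scale_left_distrib intro!: exI[of _ "\<lambda>a. k a + l a"])
qed

text \<open>The vectors whose image lies in the cone form a submonoid containing the generators,
  hence contain their hull \<open>S\<close>.\<close>

lemma qvec_in_rat_cone:
  assumes "affine_semigroup S" "x \<in> S"
  shows "qvec x \<in> rat_cone S"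
proof -
  let ?T = "{x. qvec x \<in> rat_cone S}"
  have "0 \<in> ?T"
    by (auto simp: rat_cone_def qvec_def vec_eq_iff intro!: exI[of _ "\<lambda>_. 0"])
  then have "submonoid ?T"
    by (simp add: submonoid_def qvec_add rat_cone_add)
  moreover have "min_gens S \<subseteq> ?T"
  proof
    fix a assume a: "a \<in> min_gens S"
    \<comment> \<open>A generator is the combination with indicator coefficients; finiteness of
      \<open>min_gens S\<close> lets the sum collapse.\<close>
    have "(\<Sum>b\<in>min_gens S. (if b = a then 1 else 0) *s qvec b)
      = (\<Sum>b\<in>min_gens S. if b = a then qvec b else 0)"
      by (rule sum.cong) auto
    also have "\<dots> = qvec a"
      using a finite_min_gens[OF assms(1)] by simp
    finally show "a \<in> ?T"
      by (auto simp: rat_cone_def intro!: exI[of _ "\<lambda>b. if b = a then 1 else 0"])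
  qed
  ultimately have "submonoid hull min_gens S \<subseteq> ?T"
    by (rule hull_minimal[rotated])
  then show ?thesis
    using assms minimal_generating_set_min_gens unfolding minimal_generating_set_def by blast
qed

lemma gap_add_in_gaps:
  assumes "affine_semigroup S" "g \<in> gaps S" "s \<in> S" "g + s \<notin> S"
  shows "g + s \<in> gaps S"
  using assms by (simp add: gaps_iff qvec_add rat_cone_add qvec_in_rat_cone)

lemma term_order_add_right:
  assumes "term_order prec" "s \<noteq> 0"
  shows "prec x (x + s)"
proof -
  have "prec (0 + x) (s + x)"
    using assms unfolding term_order_def by blast
  then show ?thesis by (simp add: add.commute)
qed

lemma term_order_asym:
  assumes "term_order prec" "prec x y"
  shows "\<not> prec y x"
  using assms unfolding term_order_def by (meson irreflpD transpD)

lemma gap_below_pseudo_Frobenius: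
  fixes S :: "(nat ^ 'd) set"
    and prec :: "nat ^ 'd \<Rightarrow> nat ^ 'd \<Rightarrow> bool"
  assumes S: "affine_semigroup S" and fin: "finite (gaps S)" and ord: "term_order prec"
    and g: "g \<in> gaps S"
  shows "\<exists>s\<in>S. g + s \<in> pseudo_Frobenius S"
proof -
  \<comment> \<open>\<open>H\<close> collects the gaps reachable from \<open>g\<close> by adding
    elements of \<open>S\<close>; its maximal element is the candidate.\<close>
  define H where "H = {h \<in> gaps S. \<exists>s\<in>S. h = g + s}"
  have sub: "submonoid S" by (rule affine_semigroup_submonoid[OF S])
  have "g \<in> H"
    using g sub by (auto simp: H_def submonoid_def intro!: bexI[of _ 0])
  moreover have "finite H" using fin by (simp add: H_def)
  moreover have "transp_on H prec" "asymp_on H prec"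
    using ord term_order_asym[OF ord]
    by (auto simp: term_order_def asymp_on_def intro: transp_on_subset)
  ultimately obtain h where h: "h \<in> H" and max: "\<forall>x\<in>H. x \<noteq> h \<longrightarrow> \<not> prec h x"
    using Finite_Set.bex_max_element[of H prec] by blast
  obtain s where s: "s \<in> S" "h = g + s" and gap: "h \<in> gaps S"
    using h by (auto simp: H_def)
  have "h + t \<in> S" if t: "t \<in> S" "t \<noteq> 0" for t
  proof (rule ccontr)
    assume "h + t \<notin> S"
    moreover have "h + t = g + (s + t)" "s + t \<in> S"
      using s t sub by (auto simp: submonoid_def add.assoc)
    \<comment> \<open>If \<open>h + t\<close> were still a gap, it would be an element of
      \<open>H\<close> strictly above \<open>h\<close>.\<close>
    ultimately have "h + t \<in> H"
      using gap_add_in_gaps[OF S gap] t unfolding H_def by blast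
    then show False
      using max t term_order_add_right[OF ord] by auto
  qed
  then have "h \<in> pseudo_Frobenius S"
    using gap by (simp add: pseudo_Frobenius_def)
  then show ?thesis using s by blast
qed

text \<open>For nonzero \<open>s\<close> in \<open>S\<close>, a sum \<open>F + s\<close> outside
  \<open>S\<close> would be a gap larger than the maximal gap \<open>F\<close>.\<close>

lemma Frobenius_element_in_pseudo_Frobenius:
  assumes S: "affine_semigroup S" and ord: "term_order prec"
    and F: "is_Frobenius_element prec S F"
  shows "F \<in> pseudo_Frobenius S"
proof -
  have gap: "F \<in> gaps S" using F by (simp add: is_Frobenius_element_def)
  have "F + s \<in> S" if s: "s \<in> S" "s \<noteq> 0" for s
  proof (rule ccontr)
    assume "F + s \<notin> S"
    then have "F + s \<in> gaps S" using gap_add_in_gaps[OF S gap] s by blast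
    then have "prec (F + s) F" using F s by (simp add: is_Frobenius_element_def)
    then show False using term_order_asym[OF ord] term_order_add_right[OF ord s(2)] by blast
  qed
  then show ?thesis using gap by (simp add: pseudo_Frobenius_def)
qed

theorem theorem3p6:
  fixes S :: "(nat ^ 'd) set"
    and prec :: "nat ^ 'd \<Rightarrow> nat ^ 'd \<Rightarrow> bool"
  assumes "C_semigroup S"
    and "term_order prec"
  shows "symmetric_semigroup prec S \<longleftrightarrow>
    (\<forall>g :: nat ^ 'd. qvec g \<in> rat_cone S \<longrightarrow>
      (g \<in> S \<longleftrightarrow> qvec (Frobenius_element prec S) - qvec g \<notin> qvec ` S))"
proof -
  define F where "F = Frobenius_element prec S"
  have S: "affine_semigroup S" and fin: "finite (gaps S)" and ne: "gaps S \<noteq> {}"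
    using assms(1) by (auto simp: C_semigroup_def MPD_semigroup_def)
  have sub: "submonoid S" by (rule affine_semigroup_submonoid[OF S])
  have F: "is_Frobenius_element prec S F"
    unfolding F_def Frobenius_element_def
    by (rule theI') (rule ex1_Frobenius_element[OF assms(2) fin ne])
  then have F_notin: "F \<notin> S"
    by (simp add: is_Frobenius_element_def gaps_iff)
  have sym: "symmetric_semigroup prec S \<longleftrightarrow> pseudo_Frobenius S = {F}"
    using F by (auto simp: symmetric_semigroup_def F_def)
  show ?thesis
    unfolding sym F_def[symmetric] qvec_diff_in_image_iff
  proof (rule iffI; (intro allI impI)?)
    fix g
    assume PF: "pseudo_Frobenius S = {F}" and g: "qvec g \<in> rat_cone S"
    show "g \<in> S \<longleftrightarrow> \<not> (\<exists>s\<in>S. F = g + s)"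
    proof (rule iffI)
      show "\<not> (\<exists>s\<in>S. F = g + s)" if "g \<in> S"
        using that F_notin sub by (auto simp: submonoid_def)
      \<comment> \<open>Otherwise \<open>g\<close> is a gap, and the pseudo-Frobenius element
        \<open>g + s\<close> above it must be \<open>F\<close>.\<close>
      show "g \<in> S" if "\<not> (\<exists>s\<in>S. F = g + s)"
        using that gap_below_pseudo_Frobenius[OF S fin assms(2), of g] PF g
        by (auto simp: gaps_iff)
    qed
  next
    assume R: "\<forall>g. qvec g \<in> rat_cone S \<longrightarrow> (g \<in> S \<longleftrightarrow> \<not> (\<exists>s\<in>S. F = g + s))"
    have "f = F" if f: "f \<in> pseudo_Frobenius S" for f
    proof -
      \<comment> \<open>\<open>f\<close> lies in the cone but not in \<open>S\<close>, so
        \<open>R\<close> applies to it.\<close>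
      have "\<exists>s\<in>S. F = f + s"
        using f R by (auto simp: pseudo_Frobenius_def gaps_iff)
      then obtain s where s: "s \<in> S" "F = f + s" by blast
      \<comment> \<open>A nonzero \<open>s\<close> would put \<open>F = f + s\<close> into
        \<open>S\<close>, since \<open>f\<close> is pseudo-Frobenius.\<close>
      then have "s = 0"
        using f F_notin by (auto simp: pseudo_Frobenius_def)
      then show ?thesis using s by simp
    qed
    then show "pseudo_Frobenius S = {F}"
      using Frobenius_element_in_pseudo_Frobenius[OF S assms(2) F] by blast
  qed
qed

end
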